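(* Let $n\ge 2$, $\mathcal{D}=\mathbb{C}[D_1,\dots,D_n]$ and $\mathcal{F}=\mathcal{C}^\infty(\mathsf{T})_{\mathsf{fin}}$. (1) For an ideal $\mathfrak{i}\subset\mathcal{D}$, the ideal $\mathfrak{i}^{\perp\perp}$ is the intersection of the maximal ideals $(D_1-a_1,\dots,D_n-a_n)\supset\mathfrak{i}$ with $a=(a_1,\dots,a_n)\in\mathbb{Z}^n$, and there is a one-to-one correspondence between the behaviors $\mathcal{B}\subset\mathcal{F}$ and the Zariski closed subsets $S$ of $\mathbb{C}^n$ such that $S\cap\mathbb{Z}^n$ is Zariski dense in $S$. (2) For $q\ge 1$ and a submodule $\mathcal{M}\subset\mathcal{D}^q$, the Willems closure $\mathcal{M}^{\perp\perp}$ with respect to $\mathcal{F}$ consists of the elements $r\in\mathcal{D}^q$ such that for each $a\in\mathbb{Z}^n$, $r(a)\in V(a):=\{m(a)\in\mathbb{C}^q : m\in\mathcal{M}\}$.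
   Context: $\mathcal{D}=\mathbb{C}[D_1,\dots,D_n]$ is the commutative polynomial ring of constant coefficient differential operators on $\mathbb{R}^n$, with $D_j=\frac{1}{\imath}\frac{\partial}{\partial x_j}$. For $m=(m_1,\dots,m_q)\in\mathcal{D}^q$ and $a\in\mathbb{C}^n$, $m(a)=(m_1(a),\dots,m_q(a))\in\mathbb{C}^q$, where $m_i(a)$ is the polynomial $m_i$ evaluated at $D_j=a_j$. $\mathcal{C}^\infty(\mathsf{T})_{\mathsf{fin}}$ is the $\mathcal{D}$-module of finite sums $\sum_{a\in\mathbb{Z}^n}c_ae^{\imath\langle a,x\rangle}$, $c_a\in\mathbb{C}$, $\langle a,x\rangle=\sum_ja_jx_j$. For a submodule $\mathcal{M}\subset\mathcal{D}^q$, its behavior is $\mathcal{M}^\perp=\{(f_1,\dots,f_q)\in\mathcal{F}^q : \sum_j r_j(f_j)=0 \text{ for all } (r_1,\dots,r_q)\in\mathcal{M}\}$; behaviors in $\mathcal{F}^q$ are the subsets of this form. For a behavior $\mathcal{B}\subset\mathcal{F}^q$, $\mathcal{B}^\perp=\{(r_1,\dots,r_q)\in\mathcal{D}^q : \sum_j r_j(f_j)=0 \text{ for all } (f_1,\dots,f_q)\in\mathcal{B}\}$. The Willems closure of $\mathcal{M}$ is $\mathcal{M}^{\perp\perp}$. Ideals are the case $q=1$; an intersection over the empty set is $\mathcal{D}$. The correspondence in (1) sends $\mathcal{B}=\mathfrak{i}^\perp$ to the Zariski closure of $\{a\in\mathbb{Z}^n : L(a)=0\text{ for all }L\in\mathfrak{i}\}$.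 *)

theory Defs
  imports "HOL-Analysis.Analysis" "HOL-Library.Poly_Mapping"
begin

section \<open>The ring of constant coefficient differential operators\<close>

text \<open>
  The \<open>n\<close> indeterminates are indexed by a finite type \<open>'n\<close>, so that \<open>n = CARD('n)\<close>. A polynomial
  is a finitely supported family of complex coefficients indexed by the multi-indices
  \<open>'n \<Rightarrow>\<^sub>0 nat\<close>; its ring structure is the one of \<^theory>\<open>HOL-Library.Poly_Mapping\<close>.
\<close>

type_synonym 'n diffop = "('n \<Rightarrow>\<^sub>0 nat) \<Rightarrow>\<^sub>0 complex"

definition indet :: "'n \<Rightarrow> 'n diffop" where
  "indet j = Poly_Mapping.single (Poly_Mapping.single j 1) 1"

definition const_op :: "complex \<Rightarrow> 'n diffop" where
  "const_op c = Poly_Mapping.single 0 c"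

definition eval_op :: "'n::finite diffop \<Rightarrow> complex ^ 'n \<Rightarrow> complex" where
  "eval_op p a =
     (\<Sum>\<alpha>\<in>Poly_Mapping.keys p.
        Poly_Mapping.lookup p \<alpha> * (\<Prod>j\<in>UNIV. (a $ j) ^ Poly_Mapping.lookup \<alpha> j))"

definition eval_vec :: "('n::finite diffop) ^ 'q \<Rightarrow> complex ^ 'n \<Rightarrow> complex ^ 'q" where
  "eval_vec m a = (\<chi> i. eval_op (m $ i) a)"

abbreviation is_ideal :: "'n diffop set \<Rightarrow> bool" where
  "is_ideal \<equiv> module.subspace (*)"

abbreviation is_submodule :: "(('n diffop) ^ 'q) set \<Rightarrow> bool" where
  "is_submodule \<equiv> module.subspace vector_scalar_mult"

abbreviation ideal_generated :: "'n diffop set \<Rightarrow> 'n diffop set" where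
  "ideal_generated \<equiv> module.span (*)"

lemma module_diffop: "module ((*) :: 'n diffop \<Rightarrow> 'n diffop \<Rightarrow> 'n diffop)"
  by unfold_locales (simp_all add: algebra_simps)

lemma module_diffop_vec:
  "module (vector_scalar_mult :: 'n diffop \<Rightarrow> ('n diffop) ^ 'q \<Rightarrow> ('n diffop) ^ 'q)"
  by unfold_locales (simp_all add: vector_scalar_mult_def vec_eq_iff algebra_simps)

definition maximal_ideal :: "'n diffop set \<Rightarrow> bool" where
  "maximal_ideal I \<longleftrightarrow>
     is_ideal I \<and> I \<noteq> UNIV \<and> (\<forall>J. is_ideal J \<longrightarrow> I \<subseteq> J \<longrightarrow> J = I \<or> J = UNIV)"

definition point_ideal :: "complex ^ 'n \<Rightarrow> 'n diffop set" where
  "point_ideal a = ideal_generated {indet j - const_op (a $ j) | j. True}"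

definition int_point :: "int ^ 'n \<Rightarrow> complex ^ 'n" where
  "int_point a = (\<chi> j. of_int (a $ j))"


section \<open>The signal space and the action of the operators\<close>

definition character :: "int ^ 'n \<Rightarrow> real ^ 'n::finite \<Rightarrow> complex" where
  "character a x = exp (\<i> * of_real (\<Sum>j\<in>UNIV. of_int (a $ j) * x $ j))"

definition trig_polys :: "(real ^ 'n::finite \<Rightarrow> complex) set" where
  "trig_polys = {\<lambda>x. \<Sum>a\<in>A. c a * character a x | A c. finite A}"

definition partial_D :: "'n \<Rightarrow> (real ^ 'n::finite \<Rightarrow> complex) \<Rightarrow> (real ^ 'n \<Rightarrow> complex)" where
  "partial_D j f = (\<lambda>x. 1 / \<i> * vector_derivative (\<lambda>t. f (x + t *\<^sub>R axis j 1)) (at 0))"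

text \<open>
  The monomial with exponent \<open>\<alpha>\<close> applies each \<^term>\<open>partial_D j\<close> exactly \<open>\<alpha> j\<close> times. The fold leaves the
  order of the indices open; on \<^const>\<open>trig_polys\<close> the order is irrelevant, and
  \<open>apply_op_trig_poly\<close> below computes the result.
\<close>

definition apply_monom ::
    "('n \<Rightarrow>\<^sub>0 nat) \<Rightarrow> (real ^ 'n::finite \<Rightarrow> complex) \<Rightarrow> (real ^ 'n \<Rightarrow> complex)" where
  "apply_monom \<alpha> f = Finite_Set.fold (\<lambda>j. partial_D j ^^ Poly_Mapping.lookup \<alpha> j) f UNIV"

definition apply_op ::
    "'n diffop \<Rightarrow> (real ^ 'n::finite \<Rightarrow> complex) \<Rightarrow> (real ^ 'n \<Rightarrow> complex)" where
  "apply_op p f = (\<lambda>x. \<Sum>\<alpha>\<in>Poly_Mapping.keys p. Poly_Mapping.lookup p \<alpha> * apply_monom \<alpha> f x)"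

lemma partial_D_trig_poly:
  fixes A :: "(int ^ 'n::finite) set"
  assumes "finite A"
  shows "partial_D j (\<lambda>x. \<Sum>a\<in>A. c a * character a x) = (\<lambda>x. \<Sum>a\<in>A. (c a * of_int (a $ j)) * character a x)"
proof
  fix x :: "real ^ 'n"
  have lin: "(\<Sum>k\<in>UNIV. of_int (a $ k) * (x + t *\<^sub>R axis j 1) $ k)
      = (\<Sum>k\<in>UNIV. of_int (a $ k) * x $ k) + t * of_int (a $ j)" for a :: "int ^ 'n" and t :: real
  proof -
    have "(\<Sum>k\<in>UNIV. of_int (a $ k) * (x + t *\<^sub>R axis j 1) $ k)
        = (\<Sum>k\<in>UNIV. of_int (a $ k) * x $ k + (if k = j then t * of_int (a $ j) else 0))"
      by (rule sum.cong) (auto simp: axis_def algebra_simps)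
    then show ?thesis by (simp add: sum.distrib)
  qed
  have ch: "character a (x + t *\<^sub>R axis j 1)
      = character a x * exp (of_real t * (\<i> * of_int (a $ j)))" for a :: "int ^ 'n" and t :: real
    unfolding character_def lin by (simp add: exp_add [symmetric] algebra_simps)
  have e: "((\<lambda>t. exp (of_real t * w)) has_vector_derivative w) (at 0)" for w :: complex
    by (auto intro!: derivative_eq_intros has_vector_derivative_real_field)
  have d: "((\<lambda>t. \<Sum>a\<in>A. c a * (character a x * exp (of_real t * (\<i> * of_int (a $ j)))))
      has_vector_derivative (\<Sum>a\<in>A. c a * (character a x * (\<i> * of_int (a $ j))))) (at 0)"
    by (intro has_vector_derivative_sum has_vector_derivative_mult_right e)
  show "partial_D j (\<lambda>x. \<Sum>a\<in>A. c a * character a x) x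
      = (\<Sum>a\<in>A. (c a * of_int (a $ j)) * character a x)"
    unfolding partial_D_def ch vector_derivative_at [OF d]
    unfolding sum_distrib_left by (rule sum.cong) (simp_all add: field_simps)
qed

lemma partial_D_funpow_trig_poly:
  assumes "finite A"
  shows "(partial_D j ^^ k) (\<lambda>x. \<Sum>a\<in>A. c a * character a x)
    = (\<lambda>x. \<Sum>a\<in>A. (c a * of_int (a $ j) ^ k) * character a x)"
proof (induction k)
  case (Suc k)
  have "(partial_D j ^^ Suc k) (\<lambda>x. \<Sum>a\<in>A. c a * character a x)
      = partial_D j (\<lambda>x. \<Sum>a\<in>A. (c a * of_int (a $ j) ^ k) * character a x)"
    using Suc by simp
  also have "\<dots> = (\<lambda>x. \<Sum>a\<in>A. (c a * of_int (a $ j) ^ Suc k) * character a x)"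
    by (subst partial_D_trig_poly [OF assms]) (simp add: mult_ac)
  finally show ?case .
qed simp

lemma apply_monom_trig_poly:
  fixes A :: "(int ^ 'n::finite) set"
  assumes A: "finite A"
  shows "apply_monom \<alpha> (\<lambda>x. \<Sum>a\<in>A. c a * character a x)
    = (\<lambda>x. \<Sum>a\<in>A. (c a * (\<Prod>j\<in>UNIV. of_int (a $ j) ^ Poly_Mapping.lookup \<alpha> j)) * character a x)"
proof -
  let ?F = "\<lambda>j. partial_D j ^^ Poly_Mapping.lookup \<alpha> j"
  let ?f = "\<lambda>x. \<Sum>a\<in>A. c a * character a x"
  let ?g = "\<lambda>J x. \<Sum>a\<in>A. (c a * (\<Prod>j\<in>J. of_int (a $ j) ^ Poly_Mapping.lookup \<alpha> j)) * character a x"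
  have step: "?F j (?g J) = ?g (insert j J)" if "j \<notin> J" for j and J :: "'n set"
    using that by (subst partial_D_funpow_trig_poly [OF A]) (simp add: mult_ac)
  have uniq: "y = ?g J" if "fold_graph ?F ?f J y" for J y
    using that
  proof (induction rule: fold_graph.induct)
    case (insertI j J y)
    then show ?case using step by simp
  qed simp
  have "fold_graph ?F ?f J (?g J)" if "finite J" for J
    using that
  proof (induction J rule: finite_induct)
    case empty
    show ?case using fold_graph.emptyI [of ?F ?f] by simp
  next
    case (insert j J)
    then show ?case using fold_graph.insertI [of j J ?F ?f "?g J"] step by simp
  qed
  then have "(THE y. fold_graph ?F ?f UNIV y) = ?g UNIV"
    using uniq by (intro the_equality) auto
  then show ?thesis
    by (simp add: apply_monom_def Finite_Set.fold_def)
qed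

lemma apply_op_trig_poly:
  assumes "finite A"
  shows "apply_op p (\<lambda>x. \<Sum>a\<in>A. c a * character a x)
    = (\<lambda>x. \<Sum>a\<in>A. (c a * eval_op p (int_point a)) * character a x)"
proof
  fix x
  show "apply_op p (\<lambda>x. \<Sum>a\<in>A. c a * character a x) x
    = (\<Sum>a\<in>A. (c a * eval_op p (int_point a)) * character a x)"
    unfolding apply_op_def apply_monom_trig_poly [OF assms] eval_op_def int_point_def
    by (simp add: sum_distrib_left sum_distrib_right mult_ac sum.swap [of _ "Poly_Mapping.keys p"])
qed


section \<open>Behaviors\<close>

definition ideal_perp :: "'n diffop set \<Rightarrow> (real ^ 'n::finite \<Rightarrow> complex) set" where
  "ideal_perp I = {f \<in> trig_polys. \<forall>r\<in>I. apply_op r f = (\<lambda>x. 0)}"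

definition signal_perp :: "(real ^ 'n::finite \<Rightarrow> complex) set \<Rightarrow> 'n diffop set" where
  "signal_perp B = {r. \<forall>f\<in>B. apply_op r f = (\<lambda>x. 0)}"

definition behaviors :: "(real ^ 'n::finite \<Rightarrow> complex) set set" where
  "behaviors = {ideal_perp I | I. is_ideal I}"

definition module_perp ::
    "(('n diffop) ^ 'q) set \<Rightarrow> ((real ^ 'n::finite \<Rightarrow> complex) ^ 'q) set" where
  "module_perp M =
     {f. (\<forall>j. f $ j \<in> trig_polys) \<and> (\<forall>r\<in>M. \<forall>x. (\<Sum>j\<in>UNIV. apply_op (r $ j) (f $ j) x) = 0)}"

definition signal_vec_perp ::
    "((real ^ 'n::finite \<Rightarrow> complex) ^ 'q) set \<Rightarrow> (('n diffop) ^ 'q) set" where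
  "signal_vec_perp B = {r. \<forall>f\<in>B. \<forall>x. (\<Sum>j\<in>UNIV. apply_op (r $ j) (f $ j) x) = 0}"

definition willems_closure :: "(('n::finite diffop) ^ 'q) set \<Rightarrow> (('n diffop) ^ 'q) set" where
  "willems_closure M = signal_vec_perp (module_perp M)"


section \<open>The Zariski topology on complex affine space\<close>

definition zero_set :: "'n diffop set \<Rightarrow> (complex ^ 'n::finite) set" where
  "zero_set P = {a. \<forall>p\<in>P. eval_op p a = 0}"

definition zariski :: "(complex ^ 'n::finite) topology" where
  "zariski = topology (\<lambda>U. \<exists>P. U = - zero_set P)"

lemma eval_op_superset:
  assumes "finite K" "Poly_Mapping.keys p \<subseteq> K"
  shows "eval_op p a = (\<Sum>\<alpha>\<in>K. Poly_Mapping.lookup p \<alpha> * (\<Prod>j\<in>UNIV. (a $ j) ^ Poly_Mapping.lookup \<alpha> j))"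
  unfolding eval_op_def using assms
  by (intro sum.mono_neutral_left) (auto simp: in_keys_iff)

lemma eval_op_add: "eval_op (p + q) a = eval_op p a + eval_op q a"
proof -
  let ?K = "Poly_Mapping.keys p \<union> Poly_Mapping.keys q"
  have "Poly_Mapping.keys (p + q) \<subseteq> ?K" by (rule Poly_Mapping.keys_add)
  then show ?thesis
    by (simp add: eval_op_superset [of ?K] lookup_add algebra_simps sum.distrib)
qed

lemma eval_op_zero [simp]: "eval_op 0 a = 0"
  by (simp add: eval_op_def)

lemma eval_op_sum: "eval_op (sum f A) a = (\<Sum>i\<in>A. eval_op (f i) a)"
  by (induction A rule: infinite_finite_induct) (simp_all add: eval_op_add)

lemma eval_op_single:
  "eval_op (Poly_Mapping.single \<alpha> c) a = c * (\<Prod>j\<in>UNIV. (a $ j) ^ Poly_Mapping.lookup \<alpha> j)"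
  by (simp add: eval_op_def)

lemma diffop_expand:
  "(p :: 'n diffop) = (\<Sum>\<alpha>\<in>Poly_Mapping.keys p. Poly_Mapping.single \<alpha> (Poly_Mapping.lookup p \<alpha>))"
  by (rule poly_mapping_eqI)
    (auto simp: lookup_sum lookup_single when_def in_keys_iff sum.delta)

lemma eval_op_mult: "eval_op (p * q) a = eval_op p a * eval_op q a"
proof -
  have "p * q = (\<Sum>\<alpha>\<in>Poly_Mapping.keys p. \<Sum>\<beta>\<in>Poly_Mapping.keys q.
      Poly_Mapping.single (\<alpha> + \<beta>) (Poly_Mapping.lookup p \<alpha> * Poly_Mapping.lookup q \<beta>))"
    by (subst diffop_expand [of p], subst diffop_expand [of q])
      (simp add: sum_distrib_left sum_distrib_right mult_single sum.swap [of _ "Poly_Mapping.keys p"])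
  then have "eval_op (p * q) a = (\<Sum>\<alpha>\<in>Poly_Mapping.keys p. \<Sum>\<beta>\<in>Poly_Mapping.keys q.
      Poly_Mapping.lookup p \<alpha> * Poly_Mapping.lookup q \<beta>
        * (\<Prod>j\<in>UNIV. (a $ j) ^ Poly_Mapping.lookup (\<alpha> + \<beta>) j))"
    by (simp only: eval_op_sum eval_op_single)
  also have "\<dots> = eval_op p a * eval_op q a"
    unfolding eval_op_def sum_product
    by (simp add: lookup_add power_add prod.distrib mult_ac)
  finally show ?thesis .
qed

lemma istopology_zariski: "istopology (\<lambda>U. \<exists>P. U = - (zero_set P :: (complex ^ 'n::finite) set))"
proof -
  have "\<exists>R. - zero_set P \<inter> - zero_set Q = - (zero_set R :: (complex ^ 'n) set)" for P Q
  proof -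
    have "a \<in> zero_set {p * q | p q. p \<in> P \<and> q \<in> Q} \<longleftrightarrow> (\<forall>p\<in>P. \<forall>q\<in>Q. eval_op (p * q) a = 0)"
      for a :: "complex ^ 'n"
      unfolding zero_set_def by blast
    then have "- zero_set P \<inter> - zero_set Q
        = - (zero_set {p * q | p q. p \<in> P \<and> q \<in> Q} :: (complex ^ 'n) set)"
      by (auto simp: eval_op_mult zero_set_def)
    then show ?thesis by blast
  qed
  moreover have "\<exists>R. \<Union>\<U> = - (zero_set R :: (complex ^ 'n) set)"
    if ex: "\<forall>U\<in>\<U>. \<exists>P. U = - zero_set P" for \<U>
  proof -
    obtain P where P: "\<And>U. U \<in> \<U> \<Longrightarrow> U = - zero_set (P U)" using ex by metis
    have "\<Union>\<U> = - zero_set (\<Union>U\<in>\<U>. P U)"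
      using P by (fastforce simp: zero_set_def)
    then show ?thesis by blast
  qed
  ultimately show ?thesis unfolding istopology_def by blast
qed

lemma openin_zariski: "openin zariski U \<longleftrightarrow> (\<exists>P. U = - zero_set P)"
  unfolding zariski_def topology_inverse' [OF istopology_zariski] ..

lemma topspace_zariski [simp]: "topspace zariski = UNIV"
proof -
  have "openin zariski (- zero_set {1})" by (auto simp: openin_zariski)
  moreover have "zero_set {1} = ({} :: (complex ^ 'n) set)"
    by (simp add: zero_set_def eval_op_single flip: single_one)
  ultimately show ?thesis using openin_subset by fastforce
qed

lemma closedin_zariski: "closedin zariski S \<longleftrightarrow> (\<exists>P. S = zero_set P)"
  by (simp add: closedin_def openin_zariski Compl_eq_Diff_UNIV [symmetric])

definition dense_int_varieties :: "(complex ^ 'n::finite) set set" where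
  "dense_int_varieties =
     {S. closedin zariski S \<and> subtopology zariski S closure_of (S \<inter> range int_point) = S}"

end

theory Submission
  imports Defs
begin

text \<open>
  The characters are linearly independent eigenfunctions of all operators, with \<open>p\<close> acting on the
  character of frequency \<open>a\<close> by the scalar \<open>p(a)\<close>. Hence orthogonality between operators and
  signals decouples over the frequencies: at each \<open>a\<close> it is the orthogonality of \<open>V(a)\<close> to the vector
  of Fourier coefficients, and taking the perp twice returns the subspace \<open>V(a)\<close>. For ideals, \<open>V(a)\<close>
  is \<open>0\<close> or \<open>\<complex>\<close>, so a behavior is the span of the characters at the integer points of
  a variety.
\<close>

section \<open>Polynomials and point ideals\<close>

lemma eval_op_const [simp]: "eval_op (const_op c) a = c"
  by (simp add: const_op_def eval_op_single)

lemma eval_op_one [simp]: "eval_op 1 a = 1"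
  using eval_op_const [of 1 a] by (simp add: const_op_def)

lemma eval_op_indet [simp]: "eval_op (indet j) a = a $ j"
proof -
  have "(\<Prod>k\<in>UNIV. (a $ k) ^ Poly_Mapping.lookup (Poly_Mapping.single j 1) k)
      = (\<Prod>k\<in>UNIV. if k = j then a $ k else 1)"
    by (rule prod.cong) (auto simp: lookup_single when_def)
  then show ?thesis by (simp add: indet_def eval_op_single)
qed

lemma eval_op_uminus [simp]: "eval_op (- p) a = - eval_op p a"
  using eval_op_add [of p "- p" a] by (simp add: eq_neg_iff_add_eq_0 add.commute)

lemma eval_op_diff [simp]: "eval_op (p - q) a = eval_op p a - eval_op q a"
  using eval_op_add [of p "- q" a] by simp

lemma eval_op_prod: "eval_op (prod f A) a = (\<Prod>i\<in>A. eval_op (f i) a)"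
  by (induction A rule: infinite_finite_induct) (simp_all add: eval_op_mult)

lemma const_op_add: "const_op (c + d) = const_op c + const_op d"
  by (simp add: const_op_def single_add)

lemma const_op_mult: "const_op (c * d) = const_op c * const_op d"
  by (simp add: const_op_def mult_single)

text \<open>Bridges the coefficient representation and the ring operations, which is what reduces
  \<open>diffop_induct\<close> to constants and indeterminates.\<close>

lemma single_eq_monomial:
  "Poly_Mapping.single \<alpha> c
    = const_op c * (\<Prod>j\<in>UNIV. indet j ^ Poly_Mapping.lookup \<alpha> j)"
  for \<alpha> :: "'n::finite \<Rightarrow>\<^sub>0 nat"
proof -
  have pow: "indet j ^ k = Poly_Mapping.single (Poly_Mapping.single j k) 1" for j :: 'n and k
    by (induction k) (simp_all add: indet_def mult_single flip: single_add)
  have prd: "(\<Prod>j\<in>J. Poly_Mapping.single (g j) 1) = Poly_Mapping.single (\<Sum>j\<in>J. g j) (1::complex)"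
    if "finite J" for J and g :: "'n \<Rightarrow> 'n \<Rightarrow>\<^sub>0 nat"
    using that by (induction J rule: finite_induct) (simp_all add: mult_single)
  have "(\<Sum>j\<in>UNIV. Poly_Mapping.single j (Poly_Mapping.lookup \<alpha> j)) = \<alpha>"
    by (rule poly_mapping_eqI) (simp add: lookup_sum lookup_single when_def)
  then show ?thesis
    by (simp add: pow prd const_op_def mult_single)
qed

lemma diffop_induct [case_names const indet add mult]:
  fixes p :: "'n::finite diffop"
  assumes const: "\<And>c. P (const_op c)" and indet: "\<And>j. P (indet j)"
    and add: "\<And>p q. P p \<Longrightarrow> P q \<Longrightarrow> P (p + q)" and mult: "\<And>p q. P p \<Longrightarrow> P q \<Longrightarrow> P (p * q)"
  shows "P p"
proof -
  have 0: "P 0" and 1: "P 1"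
    using const [of 0] const [of 1] by (simp_all add: const_op_def)
  have pow: "P (indet j ^ k)" for j k
    by (induction k) (simp_all add: 1 indet mult)
  have prd: "P (prod f J)" if "\<And>j. P (f j)" for f :: "'n \<Rightarrow> 'n diffop" and J
    using that by (induction J rule: infinite_finite_induct) (auto simp: 1 mult)
  have "P (sum f K)" if "\<And>k. P (f k)" for f :: "('n \<Rightarrow>\<^sub>0 nat) \<Rightarrow> 'n diffop" and K
    using that by (induction K rule: infinite_finite_induct) (auto simp: 0 add)
  then show ?thesis
    by (subst diffop_expand) (simp add: single_eq_monomial const mult prd pow)
qed

lemma is_ideal_vanishing: "is_ideal {p. \<forall>a\<in>S. eval_op p a = 0}"
  by (rule module.subspaceI [OF module_diffop]) (auto simp: eval_op_add eval_op_mult)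

text \<open>Modulo the generators each indeterminate is congruent to a constant, and such
  congruences survive sums and products; so structural induction replaces division with
  remainder.\<close>

lemma sub_const_in_point_ideal: "p - const_op (eval_op p a) \<in> point_ideal a"
proof (induction p rule: diffop_induct)
  case (const c)
  show ?case by (simp add: point_ideal_def module.span_zero [OF module_diffop])
next
  case (indet j)
  show ?case
    unfolding point_ideal_def eval_op_indet by (rule module.span_base [OF module_diffop]) blast
next
  case (add p q)
  have "p + q - const_op (eval_op (p + q) a)
      = (p - const_op (eval_op p a)) + (q - const_op (eval_op q a))"
    by (simp add: eval_op_add const_op_add)
  then show ?case
    using module.span_add [OF module_diffop add.IH [unfolded point_ideal_def]]
    by (simp only: point_ideal_def)
next
  case (mult p q)
  \<comment> \<open>Adding and subtracting \<open>q * const_op (eval_op p a)\<close> leaves ring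
    multiples of the two induction hypotheses.\<close>
  have "p * q - const_op (eval_op (p * q) a)
      = q * (p - const_op (eval_op p a)) + const_op (eval_op p a) * (q - const_op (eval_op q a))"
    unfolding eval_op_mult const_op_mult by (simp only: algebra_simps)
  then show ?case
    using module.span_add [OF module_diffop
        module.span_scale [OF module_diffop mult.IH(1) [unfolded point_ideal_def], of q]
        module.span_scale [OF module_diffop mult.IH(2) [unfolded point_ideal_def],
          of "const_op (eval_op p a)"]]
    by (simp only: point_ideal_def)
qed

text \<open>The generators vanish at \<open>a\<close>; conversely, if \<open>p\<close> vanishes
  there, the difference in \<open>sub_const_in_point_ideal\<close> is \<open>p\<close>
  itself.\<close>

lemma point_ideal_eq: "point_ideal a = {p. eval_op p a = 0}"
proof
  have "is_ideal {p. eval_op p a = 0}"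
    using is_ideal_vanishing [of "{a}"] by simp
  then show "point_ideal a \<subseteq> {p. eval_op p a = 0}"
    unfolding point_ideal_def by (intro module.span_minimal [OF module_diffop]) auto
  show "{p. eval_op p a = 0} \<subseteq> point_ideal a"
    using sub_const_in_point_ideal [of _ a] by (auto simp: const_op_def) (metis diff_zero single_zero)
qed

lemma maximal_ideal_point_ideal: "maximal_ideal (point_ideal a)"
  unfolding maximal_ideal_def
proof (intro conjI allI impI)
  show "is_ideal (point_ideal a)"
    unfolding point_ideal_def by (rule module.subspace_span [OF module_diffop])
  show "point_ideal a \<noteq> UNIV"
  proof
    assume "point_ideal a = UNIV"
    then have "1 \<in> point_ideal a" by simp
    then show False by (simp add: point_ideal_eq)
  qed
  fix J :: "'a diffop set"
  assume J: "is_ideal J" and sub: "point_ideal a \<subseteq> J"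
  show "J = point_ideal a \<or> J = UNIV"
  proof (cases "J \<subseteq> point_ideal a")
    case False
    then obtain p where p: "p \<in> J" "eval_op p a \<noteq> 0" by (auto simp: point_ideal_eq)
    have "r \<in> J" for r
    proof -
      \<comment> \<open>The constant rescales \<open>p\<close> to take the value of \<open>r\<close>
        at \<open>a\<close>, so that \<open>r - ?u\<close> vanishes there and lies in the point
        ideal.\<close>
      let ?u = "const_op (eval_op r a / eval_op p a) * p"
      have "r - ?u \<in> J" using sub p(2) by (auto simp: point_ideal_eq eval_op_mult)
      moreover have "?u \<in> J" using module.subspace_scale [OF module_diffop J p(1)] .
      ultimately have "(r - ?u) + ?u \<in> J" by (rule module.subspace_add [OF module_diffop J])
      then show ?thesis by simp
    qed
    then show ?thesis by blast
  qed (use sub in blast)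
qed


section \<open>Characters and their spectra\<close>

definition trig_poly :: "(int ^ 'n) set \<Rightarrow> (int ^ 'n \<Rightarrow> complex) \<Rightarrow> real ^ 'n::finite \<Rightarrow> complex" where
  "trig_poly A c = (\<lambda>x. \<Sum>a\<in>A. c a * character a x)"

lemma trig_polys_eq: "trig_polys = {trig_poly A c | A c. finite A}"
  by (simp add: trig_polys_def trig_poly_def)

lemma apply_op_trig:
  "finite A \<Longrightarrow> apply_op p (trig_poly A c) = trig_poly A (\<lambda>a. c a * eval_op p (int_point a))"
  unfolding trig_poly_def by (rule apply_op_trig_poly)

lemma int_point_inject [simp]: "int_point a = int_point b \<longleftrightarrow> a = b"
  by (auto simp: int_point_def vec_eq_iff)

text \<open>Each point of \<open>A\<close> differs from \<open>b\<close> in some coordinate; the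
  product of the corresponding linear factors works. Finiteness of \<open>A\<close> makes this a
  polynomial.\<close>

lemma separating_operator:
  fixes A :: "(complex ^ 'n::finite) set"
  assumes "finite A" "b \<notin> A"
  obtains p where "eval_op p b \<noteq> 0" "\<And>a. a \<in> A \<Longrightarrow> eval_op p a = 0"
proof -
  have "\<exists>j. a $ j \<noteq> b $ j" if "a \<in> A" for a
  proof -
    have "a \<noteq> b" using that assms(2) by blast
    then show ?thesis by (simp add: vec_eq_iff)
  qed
  then obtain j where j: "\<And>a. a \<in> A \<Longrightarrow> a $ j a \<noteq> b $ j a" by metis
  define p where "p = (\<Prod>a\<in>A. indet (j a) - const_op (a $ j a))"
  have "eval_op p b \<noteq> 0" using assms(1) j by (force simp: p_def eval_op_prod)
  moreover have "eval_op p a = 0" if "a \<in> A" for a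
    using assms(1) that by (auto simp: p_def eval_op_prod intro!: prod_zero)
  ultimately show ?thesis using that by blast
qed

lemma trig_poly_eq_0_iff:
  assumes A: "finite A"
  shows "trig_poly A c = (\<lambda>x. 0) \<longleftrightarrow> (\<forall>a\<in>A. c a = 0)"
proof
  assume eq: "trig_poly A c = (\<lambda>x. 0)"
  show "\<forall>a\<in>A. c a = 0"
  proof
    fix b assume b: "b \<in> A"
    obtain p where p: "eval_op p (int_point b) \<noteq> 0"
        "\<And>a. a \<in> int_point ` (A - {b}) \<Longrightarrow> eval_op p a = 0"
      by (rule separating_operator [of "int_point ` (A - {b})" "int_point b"]) (use A in auto)
    \<comment> \<open>The zero function is written as an empty sum, so that
      \<open>apply_op_trig\<close> also computes the image of zero.\<close>
    have "trig_poly A (\<lambda>a. c a * eval_op p (int_point a)) = apply_op p (trig_poly {} c)"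
      using eq apply_op_trig [OF A, of p c] by (simp add: trig_poly_def)
    also have "\<dots> = (\<lambda>x. 0)" by (simp only: apply_op_trig [OF finite.emptyI]) (simp add: trig_poly_def)
    \<comment> \<open>At the origin every character equals 1, leaving the bare sum of
      coefficients.\<close>
    finally have "trig_poly A (\<lambda>a. c a * eval_op p (int_point a)) 0 = 0" by simp
    moreover have "(\<Sum>a\<in>A. c a * eval_op p (int_point a)) = c b * eval_op p (int_point b)"
      using A b p(2) by (subst sum.remove [OF A b]) (auto intro!: sum.neutral)
    ultimately show "c b = 0" using p(1) by (simp add: trig_poly_def character_def)
  qed
qed (simp add: trig_poly_def)

lemma character_eq_trig_poly: "character a = trig_poly {a} (\<lambda>_. 1)"
  by (simp add: trig_poly_def)

definition int_zeros :: "'n::finite diffop set \<Rightarrow> (int ^ 'n) set" where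
  "int_zeros I = {a. \<forall>L\<in>I. eval_op L (int_point a) = 0}"

text \<open>An operator multiplies the coefficient at \<open>a\<close> by its value there, and
  independence lets each frequency be tested separately.\<close>

lemma trig_poly_in_ideal_perp:
  assumes "finite A"
  shows "trig_poly A c \<in> ideal_perp I \<longleftrightarrow> (\<forall>a\<in>A. c a = 0 \<or> a \<in> int_zeros I)"
  using assms
  by (auto simp: ideal_perp_def trig_polys_eq apply_op_trig trig_poly_eq_0_iff int_zeros_def)

lemma character_in_ideal_perp: "character a \<in> ideal_perp I \<longleftrightarrow> a \<in> int_zeros I"
  by (simp add: character_eq_trig_poly trig_poly_in_ideal_perp)

lemma ideal_perp_eqI:
  assumes "int_zeros I = int_zeros J"
  shows "ideal_perp I = ideal_perp J"
proof -
  have "ideal_perp I = {trig_poly A c | A c. finite A \<and> trig_poly A c \<in> ideal_perp I}" for I :: "'a diffop set"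
    by (auto simp: ideal_perp_def trig_polys_eq)
  moreover have "trig_poly A c \<in> ideal_perp I \<longleftrightarrow> trig_poly A c \<in> ideal_perp J" if "finite A" for A c
    using that assms by (simp add: trig_poly_in_ideal_perp)
  ultimately show ?thesis by blast
qed

text \<open>Testing on the single characters in the behavior gives one inclusion; for the other,
  every signal in it has its nonzero coefficients at integer zeros of \<open>I\<close>.\<close>

lemma signal_perp_ideal_perp:
  "signal_perp (ideal_perp I) = {r. \<forall>a\<in>int_zeros I. eval_op r (int_point a) = 0}"
proof (intro equalityI subsetI CollectI ballI)
  fix r a assume "r \<in> signal_perp (ideal_perp I)" "a \<in> int_zeros I"
  then have "apply_op r (trig_poly {a} (\<lambda>_. 1)) = (\<lambda>x. 0)"
    by (auto simp: signal_perp_def character_in_ideal_perp simp flip: character_eq_trig_poly)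
  then show "eval_op r (int_point a) = 0"
    by (simp add: apply_op_trig trig_poly_eq_0_iff)
next
  fix r assume r: "r \<in> {r. \<forall>a\<in>int_zeros I. eval_op r (int_point a) = 0}"
  have "apply_op r f = (\<lambda>x. 0)" if f: "f \<in> ideal_perp I" for f
  proof -
    from f obtain A c where A: "finite A" "f = trig_poly A c"
      by (auto simp: ideal_perp_def trig_polys_eq)
    with f r show ?thesis
      by (auto simp: trig_poly_in_ideal_perp apply_op_trig trig_poly_eq_0_iff)
  qed
  then show "r \<in> signal_perp (ideal_perp I)" by (simp add: signal_perp_def)
qed


section \<open>Behaviors and varieties\<close>

lemma closure_zariski_subset_zero_set:
  assumes "X \<subseteq> zero_set P"
  shows "zariski closure_of X \<subseteq> zero_set P"
  using closure_of_minimal [OF assms] closedin_zariski by blast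

text \<open>Zariski closure adds no integer points, because it stays inside
  \<open>zero_set I\<close>. Hence the closure still determines the integer zeros, which yields
  injectivity of the correspondence.\<close>

lemma closure_int_zeros_Int:
  "zariski closure_of (int_point ` int_zeros I) \<inter> range int_point = int_point ` int_zeros I"
proof
  have "zariski closure_of (int_point ` int_zeros I) \<subseteq> zero_set I"
    by (rule closure_zariski_subset_zero_set) (auto simp: int_zeros_def zero_set_def)
  then show "zariski closure_of (int_point ` int_zeros I) \<inter> range int_point \<subseteq> int_point ` int_zeros I"
    by (auto simp: int_zeros_def zero_set_def)
  show "int_point ` int_zeros I \<subseteq> zariski closure_of (int_point ` int_zeros I) \<inter> range int_point"
    using closure_of_subset [of "int_point ` int_zeros I" zariski] by auto
qed

text \<open>For closed \<open>S\<close> the relative and ambient closures agree; conversely, the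
  equation on the right makes \<open>S\<close> closed.\<close>

lemma dense_int_varieties_iff:
  "S \<in> dense_int_varieties \<longleftrightarrow> zariski closure_of (S \<inter> range int_point) = S"
proof -
  have "subtopology zariski S closure_of (S \<inter> range int_point)
      = zariski closure_of (S \<inter> range int_point)" if S: "closedin zariski S"
  proof -
    have "zariski closure_of (S \<inter> range int_point) \<subseteq> S"
      using S by (intro closure_of_minimal) auto
    then show ?thesis by (auto simp: closure_of_subtopology Int_absorb1)
  qed
  then show ?thesis
    unfolding dense_int_varieties_def by (metis (mono_tags, lifting) closedin_closure_of mem_Collect_eq)
qed

text \<open>Reading the frequencies off the behavior rather than off a defining ideal makes the map
  well defined, since several ideals may have the same behavior.\<close>

definition behavior_variety :: "(real ^ 'n::finite \<Rightarrow> complex) set \<Rightarrow> (complex ^ 'n) set" where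
  "behavior_variety B = zariski closure_of (int_point ` {a. character a \<in> B})"

lemma behavior_variety_ideal_perp:
  "behavior_variety (ideal_perp I) = zariski closure_of (int_point ` int_zeros I)"
  by (simp add: behavior_variety_def character_in_ideal_perp)

lemma bij_betw_behavior_variety:
  "bij_betw behavior_variety behaviors (dense_int_varieties :: (complex ^ 'n::finite) set set)"
  unfolding bij_betw_def
proof
  show "inj_on behavior_variety (behaviors :: (real ^ 'n \<Rightarrow> complex) set set)"
  proof (rule inj_onI)
    fix B C :: "(real ^ 'n \<Rightarrow> complex) set"
    assume "B \<in> behaviors" "C \<in> behaviors" and eq: "behavior_variety B = behavior_variety C"
    then obtain I J where IJ: "B = ideal_perp I" "C = ideal_perp J" by (auto simp: behaviors_def)
    with eq have "int_point ` int_zeros I = int_point ` int_zeros J"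
      by (metis behavior_variety_ideal_perp closure_int_zeros_Int)
    then have "int_zeros I = int_zeros J" by (simp add: inj_image_eq_iff inj_on_def)
    then show "B = C" unfolding IJ by (rule ideal_perp_eqI)
  qed
  show "behavior_variety ` behaviors = (dense_int_varieties :: (complex ^ 'n) set set)"
  proof (intro equalityI subsetI)
    fix S :: "(complex ^ 'n) set" assume "S \<in> behavior_variety ` behaviors"
    then obtain I where "S = zariski closure_of (int_point ` int_zeros I)"
      by (auto simp: behaviors_def behavior_variety_ideal_perp)
    then show "S \<in> dense_int_varieties"
      by (simp add: dense_int_varieties_iff closure_int_zeros_Int)
  next
    fix S :: "(complex ^ 'n) set" assume S: "S \<in> dense_int_varieties"
    then obtain P where P: "S = zero_set P"
      by (auto simp: dense_int_varieties_def closedin_zariski)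
    \<comment> \<open>The set \<open>P\<close> need not be an ideal; the vanishing ideal of
      \<open>S\<close> contains it and so has the same zeros.\<close>
    define I where "I = {p. \<forall>a\<in>S. eval_op p a = 0}"
    have I: "is_ideal I" unfolding I_def by (rule is_ideal_vanishing)
    have "P \<subseteq> I" by (auto simp: I_def P zero_set_def)
    then have "int_point ` int_zeros I = S \<inter> range int_point"
      by (auto simp: int_zeros_def I_def P zero_set_def)
    then have "behavior_variety (ideal_perp I) = S"
      using S by (simp add: behavior_variety_ideal_perp dense_int_varieties_iff)
    with I show "S \<in> behavior_variety ` behaviors" by (auto simp: behaviors_def)
  qed
qed


section \<open>The Willems closure of a submodule\<close>

text \<open>Take the union of the finite spectra of the components and pad the coefficients with
  zeros.\<close>

lemma common_spectrum:
  fixes f :: "(real ^ 'n::finite \<Rightarrow> complex) ^ 'q::finite"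
  assumes "\<And>j. f $ j \<in> trig_polys"
  obtains A c where "finite A" "\<And>j. f $ j = trig_poly A (c j)"
proof -
  have "\<forall>j. \<exists>A c. finite A \<and> f $ j = trig_poly A c"
    using assms unfolding trig_polys_eq by blast
  then obtain A c where A: "\<And>j. finite (A j)" "\<And>j. f $ j = trig_poly (A j) (c j)" by metis
  have "f $ j = trig_poly (\<Union>j. A j) (\<lambda>a. if a \<in> A j then c j a else 0)" for j
    unfolding A(2) trig_poly_def using A(1)
    by (intro ext sum.mono_neutral_cong_left) auto
  moreover have "finite (\<Union>j. A j)" using A(1) by simp
  ultimately show ?thesis by (rule that [rotated])
qed

text \<open>Exchanging the sums over components and frequencies gives one trigonometric polynomial,
  whose coefficient at \<open>a\<close> is a bilinear pairing in \<complex>^q.\<close>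

lemma apply_vec_trig:
  assumes A: "finite A" and f: "\<And>j. f $ j = trig_poly A (c j)"
  shows "(\<forall>x. (\<Sum>j\<in>UNIV. apply_op (r $ j) (f $ j) x) = 0)
    \<longleftrightarrow> (\<forall>a\<in>A. (\<Sum>j\<in>UNIV. c j a * eval_vec r (int_point a) $ j) = 0)"
proof -
  have "(\<lambda>x. \<Sum>j\<in>UNIV. apply_op (r $ j) (f $ j) x)
      = trig_poly A (\<lambda>a. \<Sum>j\<in>UNIV. c j a * eval_vec r (int_point a) $ j)"
    unfolding f apply_op_trig [OF A]
    by (simp add: trig_poly_def eval_vec_def sum_distrib_right sum.swap [of _ A])
  then show ?thesis using trig_poly_eq_0_iff [OF A] by (metis (no_types, lifting))
qed

lemma eval_vec_add: "eval_vec (r + s) a = eval_vec r a + eval_vec s a"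
  by (simp add: eval_vec_def vec_eq_iff eval_op_add)

lemma eval_vec_scale: "eval_vec (p *s r) a = eval_op p a *s eval_vec r a"
  by (simp add: eval_vec_def vec_eq_iff eval_op_mult)

lemma eval_vec_zero [simp]: "eval_vec 0 a = 0"
  by (simp add: eval_vec_def vec_eq_iff)

text \<open>Closure under complex scalars comes from the constant operators in the ring.\<close>

lemma subspace_eval_vec:
  assumes M: "is_submodule M"
  shows "vec.subspace ((\<lambda>m. eval_vec m a) ` M)"
proof (rule vec.subspaceI)
  show "0 \<in> (\<lambda>m. eval_vec m a) ` M"
    using module.subspace_0 [OF module_diffop_vec M] by (force simp: image_iff)
next
  fix x y assume "x \<in> (\<lambda>m. eval_vec m a) ` M" "y \<in> (\<lambda>m. eval_vec m a) ` M"
  then show "x + y \<in> (\<lambda>m. eval_vec m a) ` M"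
    using module.subspace_add [OF module_diffop_vec M] by (auto simp flip: eval_vec_add)
next
  fix c x assume "x \<in> (\<lambda>m. eval_vec m a) ` M"
  then obtain m where m: "m \<in> M" "x = eval_vec m a" by blast
  then have "c *s x = eval_vec (const_op c *s m) a" by (simp add: eval_vec_scale)
  then show "c *s x \<in> (\<lambda>m. eval_vec m a) ` M"
    using module.subspace_scale [OF module_diffop_vec M m(1)] by blast
qed

text \<open>The finite-dimensional double annihilator property, in the form of a functional that
  kills \<open>V\<close> but not \<open>v\<close>.\<close>

lemma separating_functional:
  fixes V :: "('a::field ^ 'q::finite) set"
  assumes V: "vec.subspace V" and v: "v \<notin> V"
  obtains c where "\<And>w. w \<in> V \<Longrightarrow> (\<Sum>j\<in>UNIV. c j * w $ j) = 0" "(\<Sum>j\<in>UNIV. c j * v $ j) \<noteq> 0"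
proof -
  obtain B where B: "B \<subseteq> V" "vec.independent B" "V \<subseteq> vec.span B"
    using vec.basis_exists [of V] by metis
  have v': "v \<notin> vec.span B" using v B(1) V vec.span_minimal by blast
  then have "vec.independent (insert v B)" using B(2) by (simp add: vec.independent_insertI)
  \<comment> \<open>The map \<open>g\<close> kills a basis of \<open>V\<close> and fixes
    \<open>v\<close>; the row of its matrix at a nonzero coordinate of \<open>v\<close> is the
    desired functional.\<close>
  then obtain g where g: "Vector_Spaces.linear (*s) (*s) g"
      "\<And>x. x \<in> insert v B \<Longrightarrow> g x = (if x = v then v else 0)"
    using vec.linear_independent_extend [of "insert v B" "\<lambda>x. if x = v then v else 0"] by metis
  have "v \<notin> B" using v' vec.span_base by blast
  then have B0: "g x = 0" if "x \<in> B" for x using g(2) [of x] that by auto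
  have V0: "g w = 0" if "w \<in> V" for w
    using vec.linear_eq_0_on_span [OF g(1) B0] that B(3) by blast
  have "v \<noteq> 0" using v vec.subspace_0 [OF V] by blast
  then obtain i where i: "v $ i \<noteq> 0" by (auto simp: vec_eq_iff)
  have "(\<Sum>j\<in>UNIV. matrix g $ i $ j * w $ j) = g w $ i" for w
    unfolding matrix_works [OF g(1), of w, symmetric] by (simp add: matrix_vector_mult_def)
  then show ?thesis using that [of "\<lambda>j. matrix g $ i $ j"] V0 g(2) [of v] i by simp
qed

lemma willems_closure_eq:
  fixes M :: "(('n::finite diffop) ^ 'q::finite) set"
  assumes M: "is_submodule M"
  shows "willems_closure M
    = {r. \<forall>a :: int ^ 'n. eval_vec r (int_point a) \<in> (\<lambda>m. eval_vec m (int_point a)) ` M}"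
proof (intro equalityI subsetI CollectI allI)
  fix r and a :: "int ^ 'n" assume r: "r \<in> willems_closure M"
  let ?V = "(\<lambda>m. eval_vec m (int_point a)) ` M"
  show "eval_vec r (int_point a) \<in> ?V"
  proof (rule ccontr)
    assume "eval_vec r (int_point a) \<notin> ?V"
    then obtain c where c: "\<And>w. w \<in> ?V \<Longrightarrow> (\<Sum>j\<in>UNIV. c j * w $ j) = 0"
        "(\<Sum>j\<in>UNIV. c j * eval_vec r (int_point a) $ j) \<noteq> 0"
      by (rule separating_functional [OF subspace_eval_vec [OF M]]) blast
    \<comment> \<open>A signal of the single frequency \<open>a\<close> carries the separating
      functional as its Fourier coefficients: \<open>M\<close> annihilates it, \<open>r\<close> does
      not.\<close>
    define f where "f = (\<chi> j. trig_poly {a} (\<lambda>_. c j))"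
    have f: "f $ j = trig_poly {a} (\<lambda>_. c j)" for j by (simp add: f_def)
    note perp = apply_vec_trig [of "{a}" f "\<lambda>j _. c j", OF _ f, simplified]
    have "f $ j \<in> trig_polys" for j unfolding f trig_polys_eq by blast
    moreover have "\<forall>m\<in>M. \<forall>x. (\<Sum>j\<in>UNIV. apply_op (m $ j) (f $ j) x) = 0"
      using c(1) perp by blast
    ultimately have "f \<in> module_perp M" by (simp add: module_perp_def)
    with r have "\<forall>x. (\<Sum>j\<in>UNIV. apply_op (r $ j) (f $ j) x) = 0"
      by (simp add: willems_closure_def signal_vec_perp_def)
    with c(2) perp show False by blast
  qed
next
  fix r
  assume r: "r \<in> {r. \<forall>a :: int ^ 'n. eval_vec r (int_point a) \<in> (\<lambda>m. eval_vec m (int_point a)) ` M}"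
  have "\<forall>x. (\<Sum>j\<in>UNIV. apply_op (r $ j) (f $ j) x) = 0" if f: "f \<in> module_perp M" for f
  proof -
    have "f $ j \<in> trig_polys" for j using f by (simp add: module_perp_def)
    then obtain A c where A: "finite A" and c: "\<And>j. f $ j = trig_poly A (c j)"
      by (rule common_spectrum) blast
    note perp = apply_vec_trig [OF A c]
    have "\<forall>a\<in>A. (\<Sum>j\<in>UNIV. c j a * eval_vec r (int_point a) $ j) = 0"
    proof
      fix a assume a: "a \<in> A"
      \<comment> \<open>The element \<open>m\<close> may vary with \<open>a\<close>; since the
        pairing decouples, no single \<open>m\<close> has to match \<open>r\<close> at all
        frequencies.\<close>
      obtain m where m: "m \<in> M" "eval_vec r (int_point a) = eval_vec m (int_point a)"
        using r by blast
      have "\<forall>x. (\<Sum>j\<in>UNIV. apply_op (m $ j) (f $ j) x) = 0"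
        using f m(1) by (simp add: module_perp_def)
      then show "(\<Sum>j\<in>UNIV. c j a * eval_vec r (int_point a) $ j) = 0"
        using a perp [of m] unfolding m(2) by blast
    qed
    then show ?thesis using perp by blast
  qed
  then show "r \<in> willems_closure M" by (simp add: willems_closure_def signal_vec_perp_def)
qed

theorem mainTheorem10:
  assumes "CARD('n::finite) \<ge> 2"
  shows
    "((\<forall>a :: int ^ 'n. maximal_ideal (point_ideal (int_point a)))
      \<and> (\<forall>I :: 'n diffop set. is_ideal I \<longrightarrow>
           signal_perp (ideal_perp I)
             = \<Inter>{point_ideal (int_point a) | a. I \<subseteq> point_ideal (int_point a)})
      \<and> (\<exists>\<Phi> :: (real ^ 'n \<Rightarrow> complex) set \<Rightarrow> (complex ^ 'n) set.
           bij_betw \<Phi> behaviors dense_int_varieties \<and>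
           (\<forall>I. is_ideal I \<longrightarrow>
              \<Phi> (ideal_perp I)
                = zariski closure_of {int_point a | a. \<forall>L\<in>I. eval_op L (int_point a) = 0})))
     \<and> (\<forall>M :: (('n diffop) ^ 'q::finite) set. is_submodule M \<longrightarrow>
          willems_closure M
            = {r. \<forall>a :: int ^ 'n. eval_vec r (int_point a) \<in> {eval_vec m (int_point a) | m. m \<in> M}})"
proof (intro conjI allI impI)
  show "maximal_ideal (point_ideal (int_point a))" for a :: "int ^ 'n"
    by (rule maximal_ideal_point_ideal)
  show "signal_perp (ideal_perp I)
      = \<Inter>{point_ideal (int_point a) | a. I \<subseteq> point_ideal (int_point a)}" for I :: "'n diffop set"
    \<comment> \<open>Containment of \<open>I\<close> in a point ideal means that the point is an
      integer zero. Without such zeros both sides are the whole ring.\<close>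
    unfolding signal_perp_ideal_perp point_ideal_eq int_zeros_def by blast
  have "{int_point a | a. \<forall>L\<in>I. eval_op L (int_point a) = 0} = int_point ` int_zeros I"
    for I :: "'n diffop set"
    unfolding int_zeros_def by blast
  then show "\<exists>\<Phi> :: (real ^ 'n \<Rightarrow> complex) set \<Rightarrow> (complex ^ 'n) set.
       bij_betw \<Phi> behaviors dense_int_varieties \<and>
       (\<forall>I. is_ideal I \<longrightarrow>
          \<Phi> (ideal_perp I)
            = zariski closure_of {int_point a | a. \<forall>L\<in>I. eval_op L (int_point a) = 0})"
    by (intro exI [of _ behavior_variety])
      (simp add: bij_betw_behavior_variety behavior_variety_ideal_perp)
  show "willems_closure M
      = {r. \<forall>a :: int ^ 'n. eval_vec r (int_point a) \<in> {eval_vec m (int_point a) | m. m \<in> M}}"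
    if "is_submodule M" for M :: "(('n diffop) ^ 'q::finite) set"
    unfolding willems_closure_eq [OF that] by (simp only: image_def Bex_def) blast
qed

end
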